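(* Let $B(t)$, $t\ge0$, be a $G$-Brownian motion (the canonical process on $C_0([0,\infty))$ under the $G$-expectation, with variance bounds $0\le\underline\sigma^2\le\overline\sigma^2$). Then the $G$-capacity $\hat c$ is not continuous unless $B(t)$ is a classical Brownian motion in a probability space (i.e. unless $\underline\sigma^2=\overline\sigma^2$).
   Context: Let $0\le\underline\sigma^2\le\overline\sigma^2<\infty$ and $G(a)=\frac12(\overline\sigma^2a^+-\underline\sigma^2a^-)$. Let $\Omega=C_0([0,\infty))$ be the space of real continuous paths $\omega$ with $\omega_0=0$ (topology of locally uniform convergence), $B_t(\omega)=\omega_t$, and $L_{ip}(\Omega)=\{\varphi(B_{t_1},\dots,B_{t_n}):n\ge1,\ t_i\ge0,\ \varphi\in C_{l,Lip}(\mathbb R^n)\}$, where $C_{l,Lip}(\mathbb R^n)$ is the set of $\varphi$ with $|\varphi(x)-\varphi(y)|\le C(1+|x|^m+|y|^m)|x-y|$ for some $C>0$, $m\in\mathbb N$. The $G$-expectation $\widehat{\mathbb E}$ is the sub-linear expectation (monotone, constant preserving, sub-additive, positively homogeneous functional) on $L_{ip}(\Omega)$ under which $B$ is a $G$-Brownian motion: for all $t,s\ge0$, $B_{t+s}-B_t$ is independent to $(B_{t_1},\dots,B_{t_n})$ for all $0\le t_1\le\dots\le t_n\le t$, and $B_{t+s}-B_t$ has the $G$-normal distribution $N(0,[s\underline\sigma^2,s\overline\sigma^2])$, i.e. $\widehat{\mathbb E}[\varphi(x+B_{t+s}-B_t)]=u(s,x)$ with $u$ the viscosity solution of $\partial_su=G(\partial_{xx}^2u)$,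 $u(0,\cdot)=\varphi$. Here $\bm Y$ independent to $\bm X$ means $\widehat{\mathbb E}[\varphi(\bm X,\bm Y)]=\widehat{\mathbb E}\big[\widehat{\mathbb E}[\varphi(\bm x,\bm Y)]|_{\bm x=\bm X}\big]$ for all $\varphi\in C_{l,Lip}$. There is a weakly compact family $\mathcal P$ of probability measures on $(\Omega,\mathcal B(\Omega))$ representing it: $\widehat{\mathbb E}[X]=\max_{P\in\mathcal P}E_P[X]$ for $X\in L_{ip}(\Omega)$. The $G$-capacity is $\hat c(A)=\sup_{P\in\mathcal P}P(A)$, $A\in\mathcal B(\Omega)$. A sub-additive capacity $V$ is called continuous if it is continuous from above: $V(A_n)\downarrow V(A)$ whenever $A_n\downarrow A$. *)

theory Defs
  imports "HOL-Probability.Probability"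
begin

section \<open>The path space\<close>

text \<open>
  Paths are indexed by \<^typ>\<open>real\<close>; the condition at negative times only fixes a junk value, so that
  elements of \<open>cpath\<close> correspond one-to-one to the continuous functions on \<open>[0,\<infinity>)\<close> starting at 0.
\<close>

typedef cpath = "{w :: real \<Rightarrow> real. continuous_on {0..} w \<and> w 0 = 0 \<and> (\<forall>t<0. w t = 0)}"
  by (rule exI[of _ "\<lambda>_. 0"]) auto

text \<open>The canonical process.\<close>

definition B :: "real \<Rightarrow> cpath \<Rightarrow> real" where
  "B t w = Rep_cpath w t"

text \<open>
  Topology of locally uniform convergence. As a consequence, \<open>borel\<close> at type \<open>cpath\<close> is the Borel
  sigma-algebra of the path space.
\<close>

instantiation cpath :: topological_space
begin

definition open_cpath :: "cpath set \<Rightarrow> bool" where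
  "open_cpath U \<longleftrightarrow>
     (\<forall>w\<in>U. \<exists>T\<ge>0. \<exists>e>0. \<forall>w'. (\<forall>t\<in>{0..T}. \<bar>B t w' - B t w\<bar> < e) \<longrightarrow> w' \<in> U)"

instance
proof
  show "open (UNIV :: cpath set)"
    unfolding open_cpath_def by (auto intro: exI[of _ "0::real"] exI[of _ "1::real"])
next
  fix S T :: "cpath set"
  assume S: "open S" and T: "open T"
  show "open (S \<inter> T)"
    unfolding open_cpath_def
  proof
    fix w assume w: "w \<in> S \<inter> T"
    from w S obtain t1 e1 where 1: "t1 \<ge> 0" "e1 > 0"
      "\<And>w'. (\<forall>t\<in>{0..t1}. \<bar>B t w' - B t w\<bar> < e1) \<Longrightarrow> w' \<in> S"
      unfolding open_cpath_def by blast
    from w T obtain t2 e2 where 2: "t2 \<ge> 0" "e2 > 0"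
      "\<And>w'. (\<forall>t\<in>{0..t2}. \<bar>B t w' - B t w\<bar> < e2) \<Longrightarrow> w' \<in> T"
      unfolding open_cpath_def by blast
    have "\<forall>w'. (\<forall>t\<in>{0..max t1 t2}. \<bar>B t w' - B t w\<bar> < min e1 e2) \<longrightarrow> w' \<in> S \<inter> T"
    proof (intro allI impI IntI)
      fix w' assume *: "\<forall>t\<in>{0..max t1 t2}. \<bar>B t w' - B t w\<bar> < min e1 e2"
      show "w' \<in> S" by (rule 1(3)) (use * in auto)
      show "w' \<in> T" by (rule 2(3)) (use * in auto)
    qed
    moreover have "max t1 t2 \<ge> 0" "min e1 e2 > 0" using 1 2 by auto
    ultimately show "\<exists>t\<ge>0. \<exists>e>0. \<forall>w'. (\<forall>s\<in>{0..t}. \<bar>B s w' - B s w\<bar> < e) \<longrightarrow> w' \<in> S \<inter> T"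
      by blast
  qed
next
  fix K :: "cpath set set"
  assume "\<forall>S\<in>K. open S"
  then show "open (\<Union>K)"
    unfolding open_cpath_def by (meson UnionE UnionI)
qed

end

section \<open>Cylinder random variables\<close>

text \<open>
  Vectors of varying dimension are lists; a function on \<open>\<real>\<^sup>n\<close> is a function on \<^typ>\<open>real list\<close> of which
  only the values on lists of length \<open>n\<close> matter.
\<close>

definition enorm :: "real list \<Rightarrow> real" where
  "enorm x = L2_set (\<lambda>i. x ! i) {..<length x}"

definition C_l_Lip :: "nat \<Rightarrow> (real list \<Rightarrow> real) \<Rightarrow> bool" where
  "C_l_Lip n \<phi> \<longleftrightarrow>
     (\<exists>C>0. \<exists>m::nat. \<forall>x y. length x = n \<longrightarrow> length y = n \<longrightarrow>
        \<bar>\<phi> x - \<phi> y\<bar> \<le> C * (1 + enorm x ^ m + enorm y ^ m) * enorm (map2 (-) x y))"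

definition L_ip :: "(cpath \<Rightarrow> real) set" where
  "L_ip = {X. \<exists>ts \<phi>. length ts \<ge> 1 \<and> (\<forall>t\<in>set ts. 0 \<le> t) \<and> C_l_Lip (length ts) \<phi> \<and>
                     X = (\<lambda>w. \<phi> (map (\<lambda>t. B t w) ts))}"

section \<open>The G-expectation\<close>

text \<open>
  Functionals are total on \<open>cpath \<Rightarrow> real\<close>, but only their values on \<open>L_ip\<close> are ever constrained.
\<close>

definition sublinear_expectation :: "((cpath \<Rightarrow> real) \<Rightarrow> real) \<Rightarrow> bool" where
  "sublinear_expectation E \<longleftrightarrow>
     (\<forall>X\<in>L_ip. \<forall>Y\<in>L_ip. (\<forall>w. X w \<le> Y w) \<longrightarrow> E X \<le> E Y) \<and>
     (\<forall>c. E (\<lambda>_. c) = c) \<and>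
     (\<forall>X\<in>L_ip. \<forall>Y\<in>L_ip. E (\<lambda>w. X w + Y w) \<le> E X + E Y) \<and>
     (\<forall>X\<in>L_ip. \<forall>l\<ge>0. E (\<lambda>w. l * X w) = l * E X)"

text \<open>\<open>indep_to E Y X\<close>: the random vector \<open>Y\<close> is independent to the random vector \<open>X\<close>.\<close>

definition indep_to ::
    "((cpath \<Rightarrow> real) \<Rightarrow> real) \<Rightarrow> (cpath \<Rightarrow> real) list \<Rightarrow> (cpath \<Rightarrow> real) list \<Rightarrow> bool" where
  "indep_to E Y X \<longleftrightarrow>
     (\<forall>\<phi>. C_l_Lip (length X + length Y) \<phi> \<longrightarrow>
        E (\<lambda>w. \<phi> (map (\<lambda>Z. Z w) X @ map (\<lambda>Z. Z w) Y)) =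
        E (\<lambda>w. (\<lambda>x. E (\<lambda>w'. \<phi> (x @ map (\<lambda>Z. Z w') Y))) (map (\<lambda>Z. Z w) X)))"

definition G_fun :: "real \<Rightarrow> real \<Rightarrow> real \<Rightarrow> real" where
  "G_fun \<sigma>l \<sigma>u a = (\<sigma>u\<^sup>2 * max a 0 - \<sigma>l\<^sup>2 * max (- a) 0) / 2"

text \<open>
  \<open>C12 v vs vxx\<close>: \<open>v\<close> is of class \<open>C\<^sup>1\<^sup>,\<^sup>2\<close> on \<open>(0,\<infinity>) \<times> \<real>\<close>, with time derivative \<open>vs\<close> and second space
  derivative \<open>vxx\<close>.
\<close>

definition C12 ::
    "(real \<Rightarrow> real \<Rightarrow> real) \<Rightarrow> (real \<Rightarrow> real \<Rightarrow> real) \<Rightarrow> (real \<Rightarrow> real \<Rightarrow> real) \<Rightarrow> bool" where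
  "C12 v vs vxx \<longleftrightarrow>
     (\<exists>vx.
        (\<forall>s>0. \<forall>x. ((\<lambda>r. v r x) has_real_derivative vs s x) (at s) \<and>
                   ((\<lambda>y. v s y) has_real_derivative vx s x) (at x) \<and>
                   ((\<lambda>y. vx s y) has_real_derivative vxx s x) (at x)) \<and>
        continuous_on ({0<..} \<times> UNIV) (\<lambda>(s, x). v s x) \<and>
        continuous_on ({0<..} \<times> UNIV) (\<lambda>(s, x). vs s x) \<and>
        continuous_on ({0<..} \<times> UNIV) (\<lambda>(s, x). vx s x) \<and>
        continuous_on ({0<..} \<times> UNIV) (\<lambda>(s, x). vxx s x))"

definition viscosity_subsolution :: "(real \<Rightarrow> real) \<Rightarrow> (real \<Rightarrow> real \<Rightarrow> real) \<Rightarrow> bool" where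
  "viscosity_subsolution G u \<longleftrightarrow>
     (\<forall>v vs vxx s x. C12 v vs vxx \<longrightarrow> s > 0 \<longrightarrow> u s x = v s x \<longrightarrow>
        (\<forall>r>0. \<forall>y. u r y \<le> v r y) \<longrightarrow> vs s x \<le> G (vxx s x))"

definition viscosity_supersolution :: "(real \<Rightarrow> real) \<Rightarrow> (real \<Rightarrow> real \<Rightarrow> real) \<Rightarrow> bool" where
  "viscosity_supersolution G u \<longleftrightarrow>
     (\<forall>v vs vxx s x. C12 v vs vxx \<longrightarrow> s > 0 \<longrightarrow> u s x = v s x \<longrightarrow>
        (\<forall>r>0. \<forall>y. v r y \<le> u r y) \<longrightarrow> G (vxx s x) \<le> vs s x)"

text \<open>Viscosity solutions of \<open>\<partial>\<^sub>s u = G (\<partial>\<^sub>x\<^sub>x u)\<close> with initial value \<open>f\<close>.\<close>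

definition viscosity_solution ::
    "(real \<Rightarrow> real) \<Rightarrow> (real \<Rightarrow> real) \<Rightarrow> (real \<Rightarrow> real \<Rightarrow> real) \<Rightarrow> bool" where
  "viscosity_solution G f u \<longleftrightarrow>
     continuous_on ({0..} \<times> UNIV) (\<lambda>(s, x). u s x) \<and> (\<forall>x. u 0 x = f x) \<and>
     viscosity_subsolution G u \<and> viscosity_supersolution G u"

text \<open>
  \<open>B\<close> is a G-Brownian motion under \<open>E\<close>. The last clause says that \<open>B (t + s) - B t\<close> is distributed
  as \<open>N(0, [s \<sigma>l\<^sup>2, s \<sigma>u\<^sup>2])\<close>. Viscosity solutions are unique among functions of polynomial growth in
  \<open>x\<close> (locally uniformly in \<open>s\<close>); a \<open>u\<close> given by a sublinear expectation as below has such growth, so it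
  is the viscosity solution.
\<close>

definition G_Brownian_motion :: "real \<Rightarrow> real \<Rightarrow> ((cpath \<Rightarrow> real) \<Rightarrow> real) \<Rightarrow> bool" where
  "G_Brownian_motion \<sigma>l \<sigma>u E \<longleftrightarrow>
     (\<forall>t\<ge>0. \<forall>s\<ge>0. \<forall>ts. sorted ts \<longrightarrow> (\<forall>r\<in>set ts. 0 \<le> r \<and> r \<le> t) \<longrightarrow>
        indep_to E [\<lambda>w. B (t + s) w - B t w] (map B ts)) \<and>
     (\<forall>\<phi>. C_l_Lip 1 \<phi> \<longrightarrow>
        (\<exists>u. viscosity_solution (G_fun \<sigma>l \<sigma>u) (\<lambda>x. \<phi> [x]) u \<and>
             (\<forall>t\<ge>0. \<forall>s\<ge>0. \<forall>x. E (\<lambda>w. \<phi> [x + (B (t + s) w - B t w)]) = u s x)))"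

definition G_expectation :: "real \<Rightarrow> real \<Rightarrow> ((cpath \<Rightarrow> real) \<Rightarrow> real) \<Rightarrow> bool" where
  "G_expectation \<sigma>l \<sigma>u E \<longleftrightarrow> sublinear_expectation E \<and> G_Brownian_motion \<sigma>l \<sigma>u E"

section \<open>Representing families and the G-capacity\<close>

definition path_measures :: "cpath measure set" where
  "path_measures = {P. prob_space P \<and> sets P = sets borel}"

text \<open>
  The topology of weak convergence: the coarsest one making \<open>P \<mapsto> \<integral> f dP\<close> continuous for all bounded
  continuous \<open>f\<close>. Its carrier is \<open>path_measures\<close>.
\<close>

definition weak_topology :: "cpath measure topology" where
  "weak_topology = topology_generated_by
     {{P \<in> path_measures. integral\<^sup>L P f \<in> U} | f U.
        continuous_on UNIV (f :: cpath \<Rightarrow> real) \<and> bounded (range f) \<and> open (U :: real set)}"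

text \<open>
  \<open>E X = max {E\<^sub>P X | P \<in> \<P>}\<close> on \<open>L_ip\<close>. Integrability is explicit since a non-integrable function has
  Bochner integral 0; attainment of the maximum forces \<open>\<P>\<close> to be nonempty.
\<close>

definition represents :: "cpath measure set \<Rightarrow> ((cpath \<Rightarrow> real) \<Rightarrow> real) \<Rightarrow> bool" where
  "represents \<P> E \<longleftrightarrow>
     \<P> \<subseteq> path_measures \<and>
     (\<forall>X\<in>L_ip. (\<forall>P\<in>\<P>. integrable P X \<and> integral\<^sup>L P X \<le> E X) \<and>
               (\<exists>P\<in>\<P>. integral\<^sup>L P X = E X))"

definition capacity :: "cpath measure set \<Rightarrow> cpath set \<Rightarrow> real" where
  "capacity \<P> A = (SUP P\<in>\<P>. measure P A)"

definition continuous_capacity :: "(cpath set \<Rightarrow> real) \<Rightarrow> bool" where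
  "continuous_capacity V \<longleftrightarrow>
     (\<forall>A :: nat \<Rightarrow> cpath set. (\<forall>n. A n \<in> sets borel) \<longrightarrow> decseq A \<longrightarrow>
        (\<lambda>n. V (A n)) \<longlonglongrightarrow> V (\<Inter>n. A n))"

end

theory Submission imports Defs
begin

text \<open>
  For every \<open>a\<close> between \<open>\<sigma>l\<^sup>2\<close> and \<open>\<sigma>u\<^sup>2\<close>, the sublinear law of a unit increment dominates a linear
  one with mean square \<open>a\<close>, so by independence the squared deviations \<open>(qv_dev a k)\<^sup>2\<close> of the discrete
  quadratic variation from \<open>k a\<close> can be kept of order \<open>k\<close>. By Markov's inequality the closed events
  \<open>qv_event c a n\<close>, which bound a weighted sum of these deviations, have capacity at least \<open>1/2\<close>
  for all \<open>n\<close>. If the capacity were continuous, the same would hold for their intersections over \<open>n\<close>;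
  but those are disjoint for different \<open>a\<close>, and a decreasing sequence of unions of
  infinitely many of them has empty intersection. Only the second moment of an increment has to be
  computed from the G-heat equation: it is additive and continuous in time, hence linear, so the
  solutions with initial values \<open>\<plusminus> x\<^sup>2\<close> are smooth.
\<close>

section \<open>Euclidean norms of lists and the class \<open>C_l_Lip\<close>\<close>

lemma enorm_nonneg: "0 \<le> enorm x"
  by (simp add: enorm_def L2_set_nonneg)

lemma abs_nth_le_enorm: "i < length x \<Longrightarrow> \<bar>x ! i\<bar> \<le> enorm x"
  unfolding enorm_def L2_set_def real_sqrt_abs[symmetric]
  by (intro real_sqrt_le_mono member_le_sum) auto

lemma enorm_sq: "(enorm x)\<^sup>2 = sum_list (map (\<lambda>r. r\<^sup>2) x)"
  by (simp add: enorm_def L2_set_def sum_nonneg sum_list_sum_nth atLeast0LessThan)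

lemma enorm_append_sq: "(enorm (x @ y))\<^sup>2 = (enorm x)\<^sup>2 + (enorm y)\<^sup>2"
  by (simp add: enorm_sq)

lemma enorm_append_ge: "enorm x \<le> enorm (x @ y)" "enorm y \<le> enorm (x @ y)"
  by (rule power2_le_imp_le; simp add: enorm_append_sq enorm_nonneg)+

lemma enorm_append_le: "enorm (x @ y) \<le> enorm x + enorm y"
  by (rule power2_le_imp_le) (simp_all add: enorm_append_sq enorm_nonneg power2_sum)

lemma enorm_singleton: "enorm [r] = \<bar>r\<bar>"
  by (simp add: enorm_def L2_set_def)

lemma enorm_replicate_0: "enorm (replicate n 0) = 0"
  by (simp add: enorm_def L2_set_def)

lemma map2_minus_replicate_0: "length x = n \<Longrightarrow> map2 (-) x (replicate n 0) = (x :: real list)"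
  by (rule nth_equalityI) auto

lemma map2_minus_append:
  "length x = length y \<Longrightarrow> map2 (-) (x @ x') (y @ y') = map2 (-) x y @ map2 (-) x' (y' :: real list)"
  by simp

text \<open>Up to constant factors, a single power of \<open>1 + enorm x + enorm y\<close> is
  comparable with the sum of separate powers in the definition. Its base is at least 1, so bounds
  with different exponents are brought together by raising the exponent, as the closure rules below
  do.\<close>

lemma C_l_Lip_iff:
  "C_l_Lip n \<phi> \<longleftrightarrow> (\<exists>C\<ge>0. \<exists>m::nat. \<forall>x y. length x = n \<longrightarrow> length y = n \<longrightarrow>
     \<bar>\<phi> x - \<phi> y\<bar> \<le> C * (1 + enorm x + enorm y) ^ m * enorm (map2 (-) x y))"
proof
  assume "C_l_Lip n \<phi>"
  then obtain C m where C: "C > 0" and L: "\<And>x y. length x = n \<Longrightarrow> length y = n \<Longrightarrow>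
        \<bar>\<phi> x - \<phi> y\<bar> \<le> C * (1 + enorm x ^ m + enorm y ^ m) * enorm (map2 (-) x y)"
    unfolding C_l_Lip_def by blast
  have "\<bar>\<phi> x - \<phi> y\<bar> \<le> (3 * C) * (1 + enorm x + enorm y) ^ m * enorm (map2 (-) x y)"
    if xy: "length x = n" "length y = n" for x y
  proof -
    let ?s = "1 + enorm x + enorm y"
    have "1 \<le> ?s ^ m" "enorm x ^ m \<le> ?s ^ m" "enorm y ^ m \<le> ?s ^ m"
      using enorm_nonneg[of x] enorm_nonneg[of y] by (auto intro!: one_le_power power_mono)
    then have "C * (1 + enorm x ^ m + enorm y ^ m) \<le> C * (3 * ?s ^ m)"
      using C by (intro mult_left_mono) auto
    then have "C * (1 + enorm x ^ m + enorm y ^ m) * enorm (map2 (-) x y)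
        \<le> C * (3 * ?s ^ m) * enorm (map2 (-) x y)"
      by (rule mult_right_mono) (rule enorm_nonneg)
    with L[OF xy] show ?thesis by (simp add: mult_ac)
  qed
  with C show "\<exists>C\<ge>0. \<exists>m::nat. \<forall>x y. length x = n \<longrightarrow> length y = n \<longrightarrow>
     \<bar>\<phi> x - \<phi> y\<bar> \<le> C * (1 + enorm x + enorm y) ^ m * enorm (map2 (-) x y)"
    by (intro exI[of _ "3 * C"] conjI exI[of _ m]) auto
next
  assume "\<exists>C\<ge>0. \<exists>m::nat. \<forall>x y. length x = n \<longrightarrow> length y = n \<longrightarrow>
     \<bar>\<phi> x - \<phi> y\<bar> \<le> C * (1 + enorm x + enorm y) ^ m * enorm (map2 (-) x y)"
  then obtain C m where C: "C \<ge> 0" and L: "\<And>x y. length x = n \<Longrightarrow> length y = n \<Longrightarrow>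
        \<bar>\<phi> x - \<phi> y\<bar> \<le> C * (1 + enorm x + enorm y) ^ m * enorm (map2 (-) x y)"
    by blast
  have "\<bar>\<phi> x - \<phi> y\<bar> \<le> ((C + 1) * 3 ^ m) * (1 + enorm x ^ m + enorm y ^ m) * enorm (map2 (-) x y)"
    if xy: "length x = n" "length y = n" for x y
  proof -
    \<comment> \<open>\<open>z ^ m\<close> is one of the three summands \<open>1\<close>,
      \<open>enorm x ^ m\<close>, \<open>enorm y ^ m\<close>, and
      \<open>1 + enorm x + enorm y\<close> is at most \<open>3 * z\<close>; hence the factor
      \<open>3 ^ m\<close>.\<close>
    define z where "z = max 1 (max (enorm x) (enorm y))"
    have z: "z ^ m \<le> 1 + enorm x ^ m + enorm y ^ m"
      using enorm_nonneg[of x] enorm_nonneg[of y] by (auto simp: z_def max_def)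
    have "(1 + enorm x + enorm y) ^ m \<le> (3 * z) ^ m"
      using enorm_nonneg[of x] enorm_nonneg[of y] by (intro power_mono) (auto simp: z_def)
    also have "\<dots> \<le> 3 ^ m * (1 + enorm x ^ m + enorm y ^ m)"
      using z by (simp add: power_mult_distrib)
    finally have "C * (1 + enorm x + enorm y) ^ m
        \<le> (C + 1) * (3 ^ m * (1 + enorm x ^ m + enorm y ^ m))"
      using C enorm_nonneg[of x] enorm_nonneg[of y] by (intro mult_mono) auto
    then have "C * (1 + enorm x + enorm y) ^ m * enorm (map2 (-) x y)
        \<le> (C + 1) * (3 ^ m * (1 + enorm x ^ m + enorm y ^ m)) * enorm (map2 (-) x y)"
      by (rule mult_right_mono) (rule enorm_nonneg)
    with L[OF xy] show ?thesis by (simp add: mult_ac)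
  qed
  with C show "C_l_Lip n \<phi>"
    unfolding C_l_Lip_def by (intro exI[of _ "(C + 1) * 3 ^ m"] conjI exI[of _ m]) auto
qed

lemma C_l_LipI:
  assumes "0 \<le> C"
    and "\<And>x y. length x = n \<Longrightarrow> length y = n \<Longrightarrow>
      \<bar>\<phi> x - \<phi> y\<bar> \<le> C * (1 + enorm x + enorm y) ^ m * enorm (map2 (-) x y)"
  shows "C_l_Lip n \<phi>"
  using assms unfolding C_l_Lip_iff by blast

lemma C_l_LipE:
  assumes "C_l_Lip n \<phi>"
  obtains C m where "0 \<le> C"
    and "\<And>x y. length x = n \<Longrightarrow> length y = n \<Longrightarrow>
      \<bar>\<phi> x - \<phi> y\<bar> \<le> C * (1 + enorm x + enorm y) ^ m * enorm (map2 (-) x y)"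
  using assms unfolding C_l_Lip_iff by blast

lemma C_l_Lip_const: "C_l_Lip n (\<lambda>_. c)"
  by (rule C_l_LipI[of 0 _ _ 0]) auto

lemma C_l_Lip_nth:
  assumes "i < n"
  shows "C_l_Lip n (\<lambda>x. x ! i)"
proof (rule C_l_LipI[of 1 _ _ 0])
  fix x y :: "real list"
  assume "length x = n" "length y = n"
  then show "\<bar>x ! i - y ! i\<bar> \<le> 1 * (1 + enorm x + enorm y) ^ 0 * enorm (map2 (-) x y)"
    using abs_nth_le_enorm[of i "map2 (-) x y"] assms by simp
qed simp

lemma C_l_Lip_add:
  assumes "C_l_Lip n \<phi>" "C_l_Lip n \<psi>"
  shows "C_l_Lip n (\<lambda>x. \<phi> x + \<psi> x)"
proof -
  obtain C m where C: "C \<ge> 0" and L: "\<And>x y. length x = n \<Longrightarrow> length y = n \<Longrightarrow>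
        \<bar>\<phi> x - \<phi> y\<bar> \<le> C * (1 + enorm x + enorm y) ^ m * enorm (map2 (-) x y)"
    using C_l_LipE[OF assms(1)] by blast
  obtain D k where D: "D \<ge> 0" and K: "\<And>x y. length x = n \<Longrightarrow> length y = n \<Longrightarrow>
        \<bar>\<psi> x - \<psi> y\<bar> \<le> D * (1 + enorm x + enorm y) ^ k * enorm (map2 (-) x y)"
    using C_l_LipE[OF assms(2)] by blast
  show ?thesis
  proof (rule C_l_LipI[of "C + D" _ _ "m + k"])
    fix x y :: "real list"
    assume xy: "length x = n" "length y = n"
    let ?s = "1 + enorm x + enorm y" and ?d = "enorm (map2 (-) x y)"
    have s: "1 \<le> ?s" using enorm_nonneg[of x] enorm_nonneg[of y] by simp
    have "C * ?s ^ m * ?d \<le> C * ?s ^ (m + k) * ?d" "D * ?s ^ k * ?d \<le> D * ?s ^ (m + k) * ?d"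
      using s C D by (auto intro!: mult_right_mono mult_left_mono power_increasing enorm_nonneg)
    with L[OF xy] K[OF xy] show "\<bar>\<phi> x + \<psi> x - (\<phi> y + \<psi> y)\<bar> \<le> (C + D) * ?s ^ (m + k) * ?d"
      by (simp add: distrib_right)
  qed (use C D in auto)
qed

text \<open>Comparison with the zero vector. The product rule below combines this bound on values
  with the Lipschitz bounds.\<close>

lemma C_l_Lip_growth:
  assumes "C_l_Lip n \<phi>"
  obtains C m where "0 \<le> C" and "\<And>x. length x = n \<Longrightarrow> \<bar>\<phi> x\<bar> \<le> C * (1 + enorm x) ^ m"
proof -
  obtain C m where C: "C \<ge> 0" and L: "\<And>x y. length x = n \<Longrightarrow> length y = n \<Longrightarrow>
        \<bar>\<phi> x - \<phi> y\<bar> \<le> C * (1 + enorm x + enorm y) ^ m * enorm (map2 (-) x y)"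
    using C_l_LipE[OF assms] by blast
  let ?c = "\<bar>\<phi> (replicate n 0)\<bar>"
  show thesis
  proof (rule that[of "C + ?c" "Suc m"])
    fix x :: "real list"
    assume x: "length x = n"
    let ?s = "1 + enorm x"
    have s: "1 \<le> ?s" using enorm_nonneg[of x] by simp
    have "C * ?s ^ m * enorm x \<le> C * ?s ^ m * ?s"
      using s C by (intro mult_left_mono) auto
    moreover have "?c * 1 \<le> ?c * ?s ^ Suc m"
      using s by (intro mult_left_mono one_le_power) auto
    moreover have "\<bar>\<phi> x - \<phi> (replicate n 0)\<bar> \<le> C * ?s ^ m * enorm x"
      using L[of x "replicate n 0"] x by (simp add: enorm_replicate_0 map2_minus_replicate_0)
    ultimately have "\<bar>\<phi> x\<bar> \<le> C * ?s ^ m * ?s + ?c * ?s ^ Suc m" by linarith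
    then show "\<bar>\<phi> x\<bar> \<le> (C + ?c) * ?s ^ Suc m" by (simp add: algebra_simps)
  qed (use C in auto)
qed

lemma C_l_Lip_mult:
  assumes "C_l_Lip n \<phi>" "C_l_Lip n \<psi>"
  shows "C_l_Lip n (\<lambda>x. \<phi> x * \<psi> x)"
proof -
  obtain C m where C: "C \<ge> 0" and L: "\<And>x y. length x = n \<Longrightarrow> length y = n \<Longrightarrow>
        \<bar>\<phi> x - \<phi> y\<bar> \<le> C * (1 + enorm x + enorm y) ^ m * enorm (map2 (-) x y)"
    using C_l_LipE[OF assms(1)] by blast
  obtain D k where D: "D \<ge> 0" and K: "\<And>x y. length x = n \<Longrightarrow> length y = n \<Longrightarrow>
        \<bar>\<psi> x - \<psi> y\<bar> \<le> D * (1 + enorm x + enorm y) ^ k * enorm (map2 (-) x y)"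
    using C_l_LipE[OF assms(2)] by blast
  obtain C' m' where C': "C' \<ge> 0" and L': "\<And>x. length x = n \<Longrightarrow> \<bar>\<phi> x\<bar> \<le> C' * (1 + enorm x) ^ m'"
    using C_l_Lip_growth[OF assms(1)] by blast
  obtain D' k' where D': "D' \<ge> 0" and K': "\<And>x. length x = n \<Longrightarrow> \<bar>\<psi> x\<bar> \<le> D' * (1 + enorm x) ^ k'"
    using C_l_Lip_growth[OF assms(2)] by blast
  define p where "p = m + k + m' + k'"
  show ?thesis
  proof (rule C_l_LipI[of "C' * D + D' * C" _ _ p])
    fix x y :: "real list"
    assume xy: "length x = n" "length y = n"
    let ?s = "1 + enorm x + enorm y" and ?d = "enorm (map2 (-) x y)"
    note nn = enorm_nonneg[of x] enorm_nonneg[of y] enorm_nonneg[of "map2 (-) x y"]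
    have s: "1 \<le> ?s" using nn by simp
    have "\<bar>\<phi> x\<bar> \<le> C' * ?s ^ m'"
      using L'[OF xy(1)] nn C' by (smt (verit) mult_left_mono power_mono)
    then have "\<bar>\<phi> x\<bar> * \<bar>\<psi> x - \<psi> y\<bar> \<le> (C' * ?s ^ m') * (D * ?s ^ k * ?d)"
      using K[OF xy] C' s by (intro mult_mono) auto
    also have "\<dots> = C' * D * ?s ^ (m' + k) * ?d" by (simp add: power_add)
    also have "\<dots> \<le> C' * D * ?s ^ p * ?d"
      using s C' D nn by (intro mult_right_mono mult_left_mono power_increasing) (auto simp: p_def)
    finally have 1: "\<bar>\<phi> x\<bar> * \<bar>\<psi> x - \<psi> y\<bar> \<le> C' * D * ?s ^ p * ?d" .
    have "\<bar>\<psi> y\<bar> \<le> D' * ?s ^ k'"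
      using K'[OF xy(2)] nn D' by (smt (verit) mult_left_mono power_mono)
    then have "\<bar>\<psi> y\<bar> * \<bar>\<phi> x - \<phi> y\<bar> \<le> (D' * ?s ^ k') * (C * ?s ^ m * ?d)"
      using L[OF xy] D' s by (intro mult_mono) auto
    also have "\<dots> = D' * C * ?s ^ (k' + m) * ?d" by (simp add: power_add)
    also have "\<dots> \<le> D' * C * ?s ^ p * ?d"
      using s C D' nn by (intro mult_right_mono mult_left_mono power_increasing) (auto simp: p_def)
    finally have 2: "\<bar>\<psi> y\<bar> * \<bar>\<phi> x - \<phi> y\<bar> \<le> D' * C * ?s ^ p * ?d" .
    have "\<phi> x * \<psi> x - \<phi> y * \<psi> y = \<phi> x * (\<psi> x - \<psi> y) + \<psi> y * (\<phi> x - \<phi> y)"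
      by (simp add: algebra_simps)
    then have "\<bar>\<phi> x * \<psi> x - \<phi> y * \<psi> y\<bar> \<le> \<bar>\<phi> x\<bar> * \<bar>\<psi> x - \<psi> y\<bar> + \<bar>\<psi> y\<bar> * \<bar>\<phi> x - \<phi> y\<bar>"
      by (metis abs_mult abs_triangle_ineq)
    with 1 2 show "\<bar>\<phi> x * \<psi> x - \<phi> y * \<psi> y\<bar> \<le> (C' * D + D' * C) * ?s ^ p * ?d"
      by (simp add: distrib_right)
  qed (use C D C' D' in auto)
qed

lemma C_l_Lip_uminus: "C_l_Lip n \<phi> \<Longrightarrow> C_l_Lip n (\<lambda>x. - \<phi> x)"
  using C_l_Lip_mult[OF C_l_Lip_const[of n "-1"]] by simp

lemma C_l_Lip_diff: "C_l_Lip n \<phi> \<Longrightarrow> C_l_Lip n \<psi> \<Longrightarrow> C_l_Lip n (\<lambda>x. \<phi> x - \<psi> x)"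
  using C_l_Lip_add[OF _ C_l_Lip_uminus] by simp

lemma C_l_Lip_power: "C_l_Lip n \<phi> \<Longrightarrow> C_l_Lip n (\<lambda>x. \<phi> x ^ k)"
  by (induction k) (auto intro: C_l_Lip_mult C_l_Lip_const)

lemma C_l_Lip_sum: "(\<And>i. i \<in> I \<Longrightarrow> C_l_Lip n (\<phi> i)) \<Longrightarrow> C_l_Lip n (\<lambda>x. \<Sum>i\<in>I. \<phi> i x)"
  by (induction I rule: infinite_finite_induct) (auto intro: C_l_Lip_add C_l_Lip_const)

lemmas C_l_Lip_intros = C_l_Lip_const C_l_Lip_nth C_l_Lip_add C_l_Lip_mult C_l_Lip_uminus
  C_l_Lip_diff C_l_Lip_power C_l_Lip_sum

lemma C_l_Lip_take:
  assumes "C_l_Lip n \<phi>"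
  shows "C_l_Lip (n + k) (\<lambda>x. \<phi> (take n x))"
proof -
  obtain C m where C: "C \<ge> 0" and L: "\<And>x y. length x = n \<Longrightarrow> length y = n \<Longrightarrow>
        \<bar>\<phi> x - \<phi> y\<bar> \<le> C * (1 + enorm x + enorm y) ^ m * enorm (map2 (-) x y)"
    using C_l_LipE[OF assms] by blast
  show ?thesis
  proof (rule C_l_LipI[OF C])
    fix x y :: "real list"
    assume xy: "length x = n + k" "length y = n + k"
    have le: "enorm (take n z) \<le> enorm z" for z
      using enorm_append_ge(1)[of "take n z" "drop n z"] by simp
    have "\<bar>\<phi> (take n x) - \<phi> (take n y)\<bar>
        \<le> C * (1 + enorm (take n x) + enorm (take n y)) ^ m * enorm (take n (map2 (-) x y))"
      using L[of "take n x" "take n y"] xy by (simp add: take_map take_zip)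
    also have "\<dots> \<le> C * (1 + enorm x + enorm y) ^ m * enorm (map2 (-) x y)"
      using C by (intro mult_mono power_mono mult_left_mono)
        (auto intro!: le add_mono add_nonneg_nonneg mult_nonneg_nonneg simp: enorm_nonneg)
    finally show "\<bar>\<phi> (take n x) - \<phi> (take n y)\<bar>
        \<le> C * (1 + enorm x + enorm y) ^ m * enorm (map2 (-) x y)" .
  qed
qed

lemma C_l_Lip_drop:
  assumes "C_l_Lip n \<phi>"
  shows "C_l_Lip (k + n) (\<lambda>x. \<phi> (drop k x))"
proof -
  obtain C m where C: "C \<ge> 0" and L: "\<And>x y. length x = n \<Longrightarrow> length y = n \<Longrightarrow>
        \<bar>\<phi> x - \<phi> y\<bar> \<le> C * (1 + enorm x + enorm y) ^ m * enorm (map2 (-) x y)"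
    using C_l_LipE[OF assms] by blast
  show ?thesis
  proof (rule C_l_LipI[OF C])
    fix x y :: "real list"
    assume xy: "length x = k + n" "length y = k + n"
    have le: "enorm (drop k z) \<le> enorm z" for z
      using enorm_append_ge(2)[of "drop k z" "take k z"] by simp
    have "\<bar>\<phi> (drop k x) - \<phi> (drop k y)\<bar>
        \<le> C * (1 + enorm (drop k x) + enorm (drop k y)) ^ m * enorm (drop k (map2 (-) x y))"
      using L[of "drop k x" "drop k y"] xy by (simp add: drop_map drop_zip)
    also have "\<dots> \<le> C * (1 + enorm x + enorm y) ^ m * enorm (map2 (-) x y)"
      using C by (intro mult_mono power_mono mult_left_mono)
        (auto intro!: le add_mono add_nonneg_nonneg mult_nonneg_nonneg simp: enorm_nonneg)
    finally show "\<bar>\<phi> (drop k x) - \<phi> (drop k y)\<bar>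
        \<le> C * (1 + enorm x + enorm y) ^ m * enorm (map2 (-) x y)" .
  qed
qed

section \<open>Closure properties of \<open>L_ip\<close> and measurability of the canonical
  process\<close>

lemma L_ipI:
  "ts \<noteq> [] \<Longrightarrow> (\<And>t. t \<in> set ts \<Longrightarrow> 0 \<le> t) \<Longrightarrow> C_l_Lip (length ts) \<phi> \<Longrightarrow>
    (\<lambda>w. \<phi> (map (\<lambda>t. B t w) ts)) \<in> L_ip"
  unfolding L_ip_def by (auto simp: Suc_le_eq intro!: exI[of _ ts] exI[of _ \<phi>])

text \<open>Concatenating the two time lists suffices, since \<open>L_ip\<close> asks neither for
  sorted nor for distinct times. Sums and products in \<open>L_ip\<close> thereby reduce to those in
  \<open>C_l_Lip\<close>.\<close>

lemma L_ip_common_times: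
  assumes "X \<in> L_ip" "Y \<in> L_ip"
  obtains ts \<phi> \<psi> where "ts \<noteq> []" "\<And>t. t \<in> set ts \<Longrightarrow> 0 \<le> t"
    "C_l_Lip (length ts) \<phi>" "C_l_Lip (length ts) \<psi>"
    "X = (\<lambda>w. \<phi> (map (\<lambda>t. B t w) ts))" "Y = (\<lambda>w. \<psi> (map (\<lambda>t. B t w) ts))"
proof -
  from assms obtain ts \<phi> us \<psi> where
    1: "length ts \<ge> 1" "\<forall>t\<in>set ts. 0 \<le> t" "C_l_Lip (length ts) \<phi>"
      "X = (\<lambda>w. \<phi> (map (\<lambda>t. B t w) ts))" and
    2: "\<forall>t\<in>set us. 0 \<le> t" "C_l_Lip (length us) \<psi>" "Y = (\<lambda>w. \<psi> (map (\<lambda>t. B t w) us))"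
    unfolding L_ip_def by blast
  show thesis
  proof (rule that[of "ts @ us" "\<lambda>x. \<phi> (take (length ts) x)" "\<lambda>x. \<psi> (drop (length ts) x)"])
    show "C_l_Lip (length (ts @ us)) (\<lambda>x. \<phi> (take (length ts) x))"
      using C_l_Lip_take[OF 1(3), of "length us"] by simp
    show "C_l_Lip (length (ts @ us)) (\<lambda>x. \<psi> (drop (length ts) x))"
      using C_l_Lip_drop[OF 2(2), of "length ts"] by simp
  qed (use 1 2 in auto)
qed

lemma L_ip_const: "(\<lambda>_. c) \<in> L_ip"
  using L_ipI[of "[0]" "\<lambda>_. c"] by (simp add: C_l_Lip_const)

lemma L_ip_B: "0 \<le> t \<Longrightarrow> B t \<in> L_ip"
  using L_ipI[of "[t]" "\<lambda>x. x ! 0"] by (simp add: C_l_Lip_nth)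

lemma L_ip_add: "X \<in> L_ip \<Longrightarrow> Y \<in> L_ip \<Longrightarrow> (\<lambda>w. X w + Y w) \<in> L_ip"
  by (erule (1) L_ip_common_times) (use L_ipI[OF _ _ C_l_Lip_add] in auto)

lemma L_ip_mult: "X \<in> L_ip \<Longrightarrow> Y \<in> L_ip \<Longrightarrow> (\<lambda>w. X w * Y w) \<in> L_ip"
  by (erule (1) L_ip_common_times) (use L_ipI[OF _ _ C_l_Lip_mult] in auto)

lemma L_ip_uminus: "X \<in> L_ip \<Longrightarrow> (\<lambda>w. - X w) \<in> L_ip"
  using L_ip_mult[OF L_ip_const[of "-1"]] by simp

lemma L_ip_diff: "X \<in> L_ip \<Longrightarrow> Y \<in> L_ip \<Longrightarrow> (\<lambda>w. X w - Y w) \<in> L_ip"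
  using L_ip_add[OF _ L_ip_uminus] by simp

lemma L_ip_power: "X \<in> L_ip \<Longrightarrow> (\<lambda>w. X w ^ k) \<in> L_ip"
  by (induction k) (auto intro: L_ip_mult L_ip_const)

lemma L_ip_sum: "(\<And>i. i \<in> I \<Longrightarrow> X i \<in> L_ip) \<Longrightarrow> (\<lambda>w. \<Sum>i\<in>I. X i w) \<in> L_ip"
  by (induction I rule: infinite_finite_induct) (auto intro: L_ip_add L_ip_const)

lemmas L_ip_intros = L_ip_const L_ip_B L_ip_add L_ip_mult L_ip_uminus L_ip_diff L_ip_power L_ip_sum

lemma B_0: "B 0 w = 0"
  using Rep_cpath[of w] by (simp add: B_def)

lemma L_ip_increment: "0 \<le> t \<Longrightarrow> 0 \<le> s \<Longrightarrow> (\<lambda>w. B (t + s) w - B t w) \<in> L_ip"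
  by (intro L_ip_intros) auto

lemma continuous_on_B: "continuous_on UNIV (B t)"
proof (cases "t < 0")
  case True
  then have "B t = (\<lambda>_. 0)" using Rep_cpath by (auto simp: B_def)
  then show ?thesis by simp
next
  case False
  have "open (B t -` U)" if U: "open U" for U
    unfolding open_cpath_def
  proof
    fix w assume "w \<in> B t -` U"
    with U obtain e where "e > 0" and e: "\<And>y. dist y (B t w) < e \<Longrightarrow> y \<in> U"
      by (auto simp: open_dist)
    with False show "\<exists>T\<ge>0. \<exists>e>0. \<forall>w'. (\<forall>t\<in>{0..T}. \<bar>B t w' - B t w\<bar> < e) \<longrightarrow> w' \<in> B t -` U"
      by (intro exI[of _ t] conjI exI[of _ e]) (auto simp: dist_real_def)
  qed
  then show ?thesis by (simp add: continuous_on_open_vimage)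
qed

lemma borel_measurable_B [measurable]: "B t \<in> borel_measurable borel"
  by (rule borel_measurable_continuous_onI[OF continuous_on_B])

section \<open>Additive functions and quadratic solutions of the G-heat equation\<close>

text \<open>Additivity settles the rational arguments; continuity then passes to \<open>s\<close>
  along the approximations \<open>q n\<close>.\<close>

lemma additive_continuous_eq_mult:
  fixes h :: "real \<Rightarrow> real"
  assumes cont: "continuous_on {0..} h"
    and add: "\<And>s t. 0 \<le> s \<Longrightarrow> 0 \<le> t \<Longrightarrow> h (s + t) = h s + h t"
    and s: "0 \<le> s"
  shows "h s = s * h 1"
proof -
  have nat: "h (real n * r) = real n * h r" if "0 \<le> r" for n r
  proof (induction n)
    case 0
    show ?case using add[of 0 0] by simp
  next
    case (Suc n)
    have "h (real (Suc n) * r) = h (real n * r + r)" by (simp add: algebra_simps)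
    also have "\<dots> = h (real n * r) + h r" using that by (intro add) auto
    finally show ?case using Suc by (simp add: algebra_simps)
  qed
  \<comment> \<open>Rounding \<open>s\<close> down to a multiple of \<open>1 / Suc n\<close> gives
    rationals within \<open>1 / Suc n\<close> of \<open>s\<close> that stay in \<open>{0..}\<close>,
    where \<open>h\<close> is continuous.\<close>
  define q where "q n = real (nat \<lfloor>s * real (Suc n)\<rfloor>) / real (Suc n)" for n
  have q0: "0 \<le> q n" for n by (simp add: q_def)
  have hq: "h (q n) = q n * h 1" for n
  proof -
    have "real (Suc n) * h (q n) = h (real (Suc n) * q n)" by (rule nat[OF q0, symmetric])
    also have "real (Suc n) * q n = real (nat \<lfloor>s * real (Suc n)\<rfloor>) * 1" by (simp add: q_def)
    also have "h \<dots> = real (nat \<lfloor>s * real (Suc n)\<rfloor>) * h 1" by (rule nat) simp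
    also have "\<dots> = real (Suc n) * (q n * h 1)" by (simp add: q_def)
    finally show ?thesis by (simp del: of_nat_Suc)
  qed
  have "norm (q n - s) < 1 / real (Suc n)" for n
  proof -
    have nn: "0 \<le> \<lfloor>s * real (Suc n)\<rfloor>" using s by simp
    have "\<bar>real (nat \<lfloor>s * real (Suc n)\<rfloor>) - s * real (Suc n)\<bar> < 1"
      using floor_correct[of "s * real (Suc n)"] unfolding abs_less_iff of_nat_nat[OF nn]
      by linarith
    moreover have "q n - s = (real (nat \<lfloor>s * real (Suc n)\<rfloor>) - s * real (Suc n)) / real (Suc n)"
      by (simp add: q_def field_simps del: of_nat_Suc)
    ultimately show ?thesis by (simp add: divide_strict_right_mono del: of_nat_Suc)
  qed
  then have q: "q \<longlonglongrightarrow> s" by (intro LIM_zero_cancel[OF LIMSEQ_norm_0])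
  then have "(\<lambda>n. h (q n)) \<longlonglongrightarrow> h s"
    using s q0 by (intro continuous_on_tendsto_compose[OF cont]) auto
  moreover have "(\<lambda>n. h (q n)) \<longlonglongrightarrow> s * h 1"
    unfolding hq by (intro tendsto_mult_right q)
  ultimately show ?thesis by (rule LIMSEQ_unique)
qed

text \<open>A smooth solution is its own test function, from above and from below.\<close>

lemma viscosity_solution_quadratic:
  assumes u: "viscosity_solution G f u"
    and eq: "\<And>s x. 0 \<le> s \<Longrightarrow> u s x = c2 * x\<^sup>2 + c1 * x + k * s"
  shows "k = G (2 * c2)"
proof -
  let ?v = "\<lambda>s x. c2 * x\<^sup>2 + c1 * x + k * s"
  have C12: "C12 ?v (\<lambda>_ _. k) (\<lambda>_ _. 2 * c2)"
    unfolding C12_def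
    by (intro exI[of _ "\<lambda>_ x. 2 * c2 * x + c1"] conjI allI impI)
      (auto intro!: derivative_eq_intros continuous_intros simp: case_prod_unfold)
  have "viscosity_subsolution G u" "viscosity_supersolution G u"
    using u by (auto simp: viscosity_solution_def)
  from this(1)[unfolded viscosity_subsolution_def, rule_format, OF C12, of 1 0]
    this(2)[unfolded viscosity_supersolution_def, rule_format, OF C12, of 1 0]
  show ?thesis by (simp add: eq)
qed

text \<open>\<open>G_fun \<sigma>l \<sigma>u (2 * c)\<close> is the maximum of \<open>c * a\<close>
  over the variance interval, attained at an end point chosen by the sign of \<open>c\<close>. In
  this form the sublinear law dominates a law of mean square \<open>a\<close>.\<close>

lemma G_fun_ge:
  assumes "\<sigma>l\<^sup>2 \<le> a" "a \<le> \<sigma>u\<^sup>2"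
  shows "c * a \<le> G_fun \<sigma>l \<sigma>u (2 * c)"
proof (cases "0 \<le> c")
  case True
  with assms mult_left_mono[of a "\<sigma>u\<^sup>2" c] show ?thesis by (simp add: G_fun_def mult.commute)
next
  case False
  with assms mult_left_mono_neg[of "\<sigma>l\<^sup>2" a c] show ?thesis by (simp add: G_fun_def mult.commute)
qed

section \<open>The centred discrete quadratic variation\<close>

text \<open>With independent increments of mean square \<open>a\<close> and bounded fourth moments
  this is a centred random walk, whose second moment grows at most linearly in
  \<open>k\<close>.\<close>

definition qv_dev :: "real \<Rightarrow> nat \<Rightarrow> cpath \<Rightarrow> real" where
  "qv_dev a k w = (\<Sum>i<k. (B (real i + 1) w - B (real i) w)\<^sup>2 - a)"

lemma L_ip_qv_dev: "qv_dev a k \<in> L_ip"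
  unfolding qv_dev_def[abs_def] by (intro L_ip_intros) auto

lemma borel_measurable_qv_dev [measurable]: "qv_dev a k \<in> borel_measurable borel"
  unfolding qv_dev_def[abs_def] by measurable

text \<open>The squared increments cancel, so the difference is deterministic and of order
  \<open>k\<close>, whereas a centred deviation is typically of order \<open>sqrt k\<close>.\<close>

lemma qv_dev_diff: "qv_dev a k w - qv_dev b k w = real k * (b - a)"
  by (simp add: qv_dev_def sum_subtractf algebra_simps)

section \<open>Calculus under a sublinear expectation\<close>

context
  fixes E :: "(cpath \<Rightarrow> real) \<Rightarrow> real"
  assumes E: "sublinear_expectation E"
begin

lemma E_mono: "X \<in> L_ip \<Longrightarrow> Y \<in> L_ip \<Longrightarrow> (\<And>w. X w \<le> Y w) \<Longrightarrow> E X \<le> E Y"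
  using E unfolding sublinear_expectation_def by blast

lemma E_const: "E (\<lambda>_. c) = c"
  using E unfolding sublinear_expectation_def by blast

lemma E_subadd: "X \<in> L_ip \<Longrightarrow> Y \<in> L_ip \<Longrightarrow> E (\<lambda>w. X w + Y w) \<le> E X + E Y"
  using E unfolding sublinear_expectation_def by blast

lemma E_cmult: "X \<in> L_ip \<Longrightarrow> 0 \<le> c \<Longrightarrow> E (\<lambda>w. c * X w) = c * E X"
  using E unfolding sublinear_expectation_def by blast

lemma E_diff_le: "X \<in> L_ip \<Longrightarrow> Y \<in> L_ip \<Longrightarrow> E X - E Y \<le> E (\<lambda>w. X w - Y w)"
  using E_subadd[of "\<lambda>w. X w - Y w" Y] by (simp add: L_ip_diff)

text \<open>Subadditivity gives both directions, once with \<open>c\<close> and once with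
  \<open>- c\<close>.\<close>

lemma E_add_const: "X \<in> L_ip \<Longrightarrow> E (\<lambda>w. c + X w) = c + E X"
  using E_subadd[of "\<lambda>_. c" X] E_diff_le[of X "\<lambda>_. - c"]
  by (simp add: L_ip_const E_const add.commute)

lemma C_l_Lip_E_append:
  assumes \<phi>: "C_l_Lip (Suc n) \<phi>" and Y: "Y \<in> L_ip"
    and L_ip: "\<And>x. length x = n \<Longrightarrow> (\<lambda>w. \<phi> (x @ [Y w])) \<in> L_ip"
  shows "C_l_Lip n (\<lambda>x. E (\<lambda>w. \<phi> (x @ [Y w])))"
proof -
  obtain C m where C: "C \<ge> 0" and L: "\<And>x y. length x = Suc n \<Longrightarrow> length y = Suc n \<Longrightarrow>
        \<bar>\<phi> x - \<phi> y\<bar> \<le> C * (1 + enorm x + enorm y) ^ m * enorm (map2 (-) x y)"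
    using C_l_LipE[OF \<phi>] by blast
  \<comment> \<open>\<open>\<bar>Y w\<bar>\<close> enters the Lipschitz bound twice. As
    \<open>2 * \<bar>Y w\<bar> \<le> 1 + (Y w)\<^sup>2\<close>, the bound splits into a factor in
    \<open>x\<close>, \<open>y\<close> and a power of \<open>2 + (Y w)\<^sup>2\<close>, which lies
    in \<open>L_ip\<close> by the closure rules.\<close>
  let ?Z = "\<lambda>w. (2 + (Y w)\<^sup>2) ^ m"
  have Z: "?Z \<in> L_ip" by (intro L_ip_intros Y)
  have Z0: "0 \<le> E ?Z" using E_mono[OF L_ip_const Z, of 0] by (simp add: E_const)
  have le: "E (\<lambda>w. \<phi> (x @ [Y w])) - E (\<lambda>w. \<phi> (y @ [Y w]))
      \<le> (C * E ?Z) * (1 + enorm x + enorm y) ^ m * enorm (map2 (-) x y)"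
    if xy: "length x = n" "length y = n" for x y
  proof -
    let ?s = "1 + enorm x + enorm y" and ?d = "enorm (map2 (-) x y)"
    note nn = enorm_nonneg[of x] enorm_nonneg[of y] enorm_nonneg[of "map2 (-) x y"]
    have pt: "\<phi> (x @ [Y w]) - \<phi> (y @ [Y w]) \<le> (C * ?s ^ m * ?d) * ?Z w" for w
    proof -
      \<comment> \<open>The common last coordinate cancels and leaves an appended 0.\<close>
      have d: "enorm (map2 (-) (x @ [Y w]) (y @ [Y w])) \<le> ?d"
        using enorm_append_le[of "map2 (-) x y" "[0]"] xy
        by (simp add: map2_minus_append enorm_singleton del: zip_append)
      have "2 * \<bar>Y w\<bar> \<le> 1 + (Y w)\<^sup>2"
        using zero_le_power2[of "\<bar>Y w\<bar> - 1"] by (simp add: power2_diff)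
      then have "?s + 2 * \<bar>Y w\<bar> \<le> ?s + (1 + (Y w)\<^sup>2)" by simp
      also have "\<dots> \<le> ?s * (2 + (Y w)\<^sup>2)"
        using mult_right_mono[of 1 ?s "1 + (Y w)\<^sup>2"] nn by (simp add: algebra_simps)
      finally have s: "1 + enorm (x @ [Y w]) + enorm (y @ [Y w]) \<le> ?s * (2 + (Y w)\<^sup>2)"
        using enorm_append_le[of x "[Y w]"] enorm_append_le[of y "[Y w]"]
        by (simp add: enorm_singleton)
      have "\<phi> (x @ [Y w]) - \<phi> (y @ [Y w])
          \<le> C * (1 + enorm (x @ [Y w]) + enorm (y @ [Y w])) ^ m
              * enorm (map2 (-) (x @ [Y w]) (y @ [Y w]))"
        using L[of "x @ [Y w]" "y @ [Y w]"] xy by simp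
      also have "\<dots> \<le> C * (?s * (2 + (Y w)\<^sup>2)) ^ m * ?d"
        using C nn by (intro mult_mono power_mono mult_left_mono s d)
          (auto intro!: add_nonneg_nonneg mult_nonneg_nonneg simp: enorm_nonneg)
      finally show ?thesis by (simp add: power_mult_distrib mult_ac)
    qed
    have "E (\<lambda>w. \<phi> (x @ [Y w])) - E (\<lambda>w. \<phi> (y @ [Y w]))
        \<le> E (\<lambda>w. \<phi> (x @ [Y w]) - \<phi> (y @ [Y w]))"
      using xy by (intro E_diff_le L_ip)
    also have "\<dots> \<le> E (\<lambda>w. (C * ?s ^ m * ?d) * ?Z w)"
      using xy by (intro E_mono pt L_ip L_ip_diff L_ip_mult[OF L_ip_const Z])
    also have "\<dots> = (C * ?s ^ m * ?d) * E ?Z"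
      using C nn by (intro E_cmult Z) auto
    finally show ?thesis by (simp add: mult_ac)
  qed
  show ?thesis
  proof (rule C_l_LipI[of "C * E ?Z" _ _ m])
    fix x y :: "real list"
    assume xy: "length x = n" "length y = n"
    have "enorm (map2 (-) y x) = enorm (map2 (-) x y)"
      using xy by (simp add: enorm_def L2_set_def power2_commute)
    then show "\<bar>E (\<lambda>w. \<phi> (x @ [Y w])) - E (\<lambda>w. \<phi> (y @ [Y w]))\<bar>
        \<le> C * E ?Z * (1 + enorm x + enorm y) ^ m * enorm (map2 (-) x y)"
      using le[OF xy] le[OF xy(2,1)] by (simp add: add_ac)
  qed (use C Z0 in simp)
qed


section \<open>First and second moments of the increments\<close>

context
  fixes \<sigma>l \<sigma>u :: real
  assumes G: "G_Brownian_motion \<sigma>l \<sigma>u E"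
begin

lemma E_indep_increment:
  assumes "0 \<le> t" "0 \<le> s" "sorted ts" "\<And>r. r \<in> set ts \<Longrightarrow> 0 \<le> r \<and> r \<le> t"
    and "C_l_Lip (Suc (length ts)) \<phi>"
  shows "E (\<lambda>w. \<phi> (map (\<lambda>r. B r w) ts @ [B (t + s) w - B t w])) =
    E (\<lambda>w. E (\<lambda>w'. \<phi> (map (\<lambda>r. B r w) ts @ [B (t + s) w' - B t w'])))"
proof -
  have "indep_to E [\<lambda>w. B (t + s) w - B t w] (map B ts)"
    using G assms unfolding G_Brownian_motion_def by blast
  then show ?thesis
    using assms(5) by (simp add: indep_to_def comp_def)
qed

text \<open>The function \<open>u\<close> that gives the law of an increment depends only on its
  length \<open>s\<close>, so \<open>t\<close> may be moved to 0, where \<open>B\<close>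
  vanishes.\<close>

lemma E_increment_stationary:
  assumes "0 \<le> t" "0 \<le> s" and p: "C_l_Lip 1 (\<lambda>x. p (x ! 0))"
  shows "E (\<lambda>w. p (B (t + s) w - B t w)) = E (\<lambda>w. p (B s w))"
proof -
  obtain u where
    "\<forall>t\<ge>0. \<forall>s\<ge>0. \<forall>x. E (\<lambda>w. p ([x + (B (t + s) w - B t w)] ! 0)) = u s x"
    using G p unfolding G_Brownian_motion_def by blast
  then have u: "E (\<lambda>w. p (x + (B (t + s) w - B t w))) = u s x" if "0 \<le> t" "0 \<le> s" for t s x
    using that by simp
  show ?thesis using u[of t s 0] u[of 0 s 0] assms by (simp add: B_0)
qed

text \<open>Independence makes \<open>h\<close> additive, and as a time section of \<open>u\<close>
  it is continuous; so it is linear, \<open>u\<close> is a polynomial, and the equation determines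
  the slope. Used with \<open>c2 = 0\<close> for the mean and with \<open>c1 = 0\<close> for the
  mean square.\<close>

lemma E_increment_quadratic:
  assumes eq: "\<And>t s x. 0 \<le> t \<Longrightarrow> 0 \<le> s \<Longrightarrow>
      E (\<lambda>w. c2 * (x + (B (t + s) w - B t w))\<^sup>2 + c1 * (x + (B (t + s) w - B t w)))
        = c2 * x\<^sup>2 + c1 * x + h s"
    and s: "0 \<le> s"
  shows "h s = s * G_fun \<sigma>l \<sigma>u (2 * c2)"
proof -
  let ?p = "\<lambda>x::real. c2 * x\<^sup>2 + c1 * x"
  have "C_l_Lip 1 (\<lambda>x. ?p (x ! 0))" by (intro C_l_Lip_intros) auto
  then obtain u where u: "viscosity_solution (G_fun \<sigma>l \<sigma>u) (\<lambda>x. ?p ([x] ! 0)) u"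
    and Eu: "\<forall>t\<ge>0. \<forall>s\<ge>0. \<forall>x. E (\<lambda>w. ?p ([x + (B (t + s) w - B t w)] ! 0)) = u s x"
    using G unfolding G_Brownian_motion_def by blast
  have u_eq: "u s x = ?p x + h s" if "0 \<le> s" for s x
    using Eu[rule_format, OF order_refl that, of x] eq[OF order_refl that, of x] by simp
  have hB: "h s = E (\<lambda>w. ?p (B s w))" if "0 \<le> s" for s
    using eq[of 0 s 0] that by (simp add: B_0)
  have "continuous_on {0..} (\<lambda>s. u s 0)"
  proof -
    have "continuous_on ({0..} \<times> UNIV) (\<lambda>(s, x). u s x)"
      using u by (simp add: viscosity_solution_def)
    then have "continuous_on {0..} (\<lambda>s. (\<lambda>(s, x). u s x) (s, 0))"
      by (rule continuous_on_compose2) (auto intro!: continuous_intros)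
    then show ?thesis by simp
  qed
  then have cont: "continuous_on {0..} h"
    by (rule continuous_on_eq) (simp add: u_eq)
  \<comment> \<open>The path is split at time \<open>s\<close>. With \<open>B s\<close> frozen,
    \<open>eq\<close> evaluates the inner expectation to \<open>?p (B s w) + h t\<close>, and
    \<open>h t\<close> leaves the outer one as a constant.\<close>
  have add: "h (s + t) = h s + h t" if st: "0 \<le> s" "0 \<le> t" for s t
  proof -
    have C: "C_l_Lip (Suc (length [s])) (\<lambda>x. ?p (x ! 0 + x ! 1))"
      by (intro C_l_Lip_intros) auto
    have "h (s + t) = E (\<lambda>w. ?p (B s w + (B (s + t) w - B s w)))"
      using hB[of "s + t"] st by simp
    also have "\<dots> = E (\<lambda>w. E (\<lambda>w'. ?p (B s w + (B (s + t) w' - B s w'))))"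
      using E_indep_increment[OF st _ _ C] st by simp
    also have "\<dots> = E (\<lambda>w. h t + ?p (B s w))"
      using eq[of s t] st by (simp add: add_ac)
    also have "\<dots> = h t + E (\<lambda>w. ?p (B s w))"
      by (intro E_add_const L_ip_intros st)
    finally show ?thesis using hB st by simp
  qed
  have lin: "h s = s * h 1" if "0 \<le> s" for s
    using additive_continuous_eq_mult[OF cont add that] .
  have "u s x = c2 * x\<^sup>2 + c1 * x + h 1 * s" if "0 \<le> s" for s x
    using u_eq[OF that, of x] lin[OF that] by simp
  from viscosity_solution_quadratic[OF u this] lin[OF s] show ?thesis by simp
qed

text \<open>The slope is \<open>G_fun \<sigma>l \<sigma>u 0 = 0\<close> for \<open>c\<close> of
  either sign: increments carry no mean uncertainty.\<close>

lemma E_increment: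
  assumes t: "0 \<le> t" and s: "0 \<le> s"
  shows "E (\<lambda>w. c * (B (t + s) w - B t w)) = 0"
proof -
  have st: "E (\<lambda>w. c * (B (t + s) w - B t w)) = E (\<lambda>w. c * B s w)"
    if "0 \<le> t" "0 \<le> s" for t s
    using that by (intro E_increment_stationary[of _ _ "\<lambda>x. c * x"] C_l_Lip_intros) auto
  have "E (\<lambda>w. c * (x + (B (t + s) w - B t w))) = c * x + E (\<lambda>w. c * B s w)"
    if "0 \<le> t" "0 \<le> s" for t s x
    using E_add_const[OF L_ip_mult[OF L_ip_const L_ip_increment[OF that]], of "c * x" c] st[OF that]
    by (simp add: distrib_left)
  then have "E (\<lambda>w. c * B s w) = s * G_fun \<sigma>l \<sigma>u (2 * 0)"
    using E_increment_quadratic[of 0 c "\<lambda>s. E (\<lambda>w. c * B s w)"] s by simp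
  with st[OF t s] show ?thesis by (simp add: G_fun_def)
qed

lemma E_increment_square:
  assumes t: "0 \<le> t" and s: "0 \<le> s"
  shows "E (\<lambda>w. c * (B (t + s) w - B t w)\<^sup>2) = s * G_fun \<sigma>l \<sigma>u (2 * c)"
proof -
  have st: "E (\<lambda>w. c * (B (t + s) w - B t w)\<^sup>2) = E (\<lambda>w. c * (B s w)\<^sup>2)"
    if "0 \<le> t" "0 \<le> s" for t s
    using that by (intro E_increment_stationary[of _ _ "\<lambda>x. c * x\<^sup>2"] C_l_Lip_intros) auto
  have "E (\<lambda>w. c * (x + (B (t + s) w - B t w))\<^sup>2) = c * x\<^sup>2 + E (\<lambda>w. c * (B s w)\<^sup>2)"
    if ts: "0 \<le> t" "0 \<le> s" for t s x
  proof -
    let ?Y = "\<lambda>w. B (t + s) w - B t w"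
    note Y = L_ip_increment[OF ts]
    have L1: "(\<lambda>w. k * ?Y w) \<in> L_ip" for k by (rule L_ip_mult[OF L_ip_const Y])
    have L2: "(\<lambda>w. c * (?Y w)\<^sup>2) \<in> L_ip" by (rule L_ip_mult[OF L_ip_const L_ip_power[OF Y]])
    have "E (\<lambda>w. c * (?Y w)\<^sup>2 + 2 * c * x * ?Y w) = E (\<lambda>w. c * (?Y w)\<^sup>2)"
      using E_subadd[OF L2 L1[of "2 * c * x"]] E_diff_le[OF L2 L1[of "- (2 * c * x)"]]
        E_increment[OF ts, of "2 * c * x"] E_increment[OF ts, of "- (2 * c * x)"]
      by (intro antisym) simp_all
    moreover have "E (\<lambda>w. c * (x + ?Y w)\<^sup>2)
        = E (\<lambda>w. c * x\<^sup>2 + (c * (?Y w)\<^sup>2 + 2 * c * x * ?Y w))"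
      by (rule arg_cong[of _ _ E], rule ext) (simp add: power2_sum distrib_left)
    ultimately show ?thesis
      using E_add_const[OF L_ip_add[OF L2 L1[of "2 * c * x"]], of "c * x\<^sup>2"] st[OF ts] by simp
  qed
  then have "E (\<lambda>w. c * (B s w)\<^sup>2) = s * G_fun \<sigma>l \<sigma>u (2 * c)"
    using E_increment_quadratic[of c 0 "\<lambda>s. E (\<lambda>w. c * (B s w)\<^sup>2)"] s by simp
  with st[OF t s] show ?thesis by simp
qed

section \<open>A lower bound for weighted sums of squared deviations\<close>

lemma E_one_step:
  assumes a: "\<sigma>l\<^sup>2 \<le> a" "a \<le> \<sigma>u\<^sup>2" and t: "0 \<le> t" and \<alpha>: "0 \<le> \<alpha>"
  shows "c - \<alpha> * m\<^sup>2 - \<alpha> * E (\<lambda>w. B 1 w ^ 4)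
    \<le> E (\<lambda>w. c - \<alpha> * (m + ((B (t + 1) w - B t w)\<^sup>2 - a))\<^sup>2)"
proof -
  let ?Y = "\<lambda>w. B (t + 1) w - B t w" and ?k = "- (2 * \<alpha> * (m - a))"
  have Y: "?Y \<in> L_ip" using L_ip_increment[OF t, of 1] by simp
  have L2: "(\<lambda>w. ?k * (?Y w)\<^sup>2) \<in> L_ip" by (rule L_ip_mult[OF L_ip_const L_ip_power[OF Y]])
  have L4: "(\<lambda>w. \<alpha> * ?Y w ^ 4) \<in> L_ip" by (rule L_ip_mult[OF L_ip_const L_ip_power[OF Y]])
  have "E (\<lambda>w. ?Y w ^ 4) = E (\<lambda>w. B 1 w ^ 4)"
    using t by (intro E_increment_stationary[of _ _ "\<lambda>x. x ^ 4"] C_l_Lip_intros) auto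
  then have E4: "E (\<lambda>w. \<alpha> * ?Y w ^ 4) = \<alpha> * E (\<lambda>w. B 1 w ^ 4)"
    using E_cmult[OF L_ip_power[OF Y] \<alpha>] by simp
  have E2: "?k * a \<le> E (\<lambda>w. ?k * (?Y w)\<^sup>2)"
    using E_increment_square[OF t, of 1 ?k] G_fun_ge[OF a, of ?k] by simp
  have "E (\<lambda>w. c - \<alpha> * (m + ((?Y w)\<^sup>2 - a))\<^sup>2)
      = E (\<lambda>w. (c - \<alpha> * (m - a)\<^sup>2) + (?k * (?Y w)\<^sup>2 - \<alpha> * ?Y w ^ 4))"
  proof (rule arg_cong[of _ _ E], rule ext)
    fix w
    show "c - \<alpha> * (m + ((?Y w)\<^sup>2 - a))\<^sup>2
        = (c - \<alpha> * (m - a)\<^sup>2) + (?k * (?Y w)\<^sup>2 - \<alpha> * ?Y w ^ 4)"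
      by algebra
  qed
  also have "\<dots> = (c - \<alpha> * (m - a)\<^sup>2) + E (\<lambda>w. ?k * (?Y w)\<^sup>2 - \<alpha> * ?Y w ^ 4)"
    by (rule E_add_const[OF L_ip_diff[OF L2 L4]])
  also have "\<dots> \<ge> (c - \<alpha> * (m - a)\<^sup>2) + (?k * a - \<alpha> * E (\<lambda>w. B 1 w ^ 4))"
    using E_diff_le[OF L2 L4] E4 E2 by simp
  \<comment> \<open>The terms in \<open>m * a\<close> cancel; the surplus
    \<open>\<alpha> * a\<^sup>2\<close> is nonnegative and is dropped at the end.\<close>
  also have "(c - \<alpha> * (m - a)\<^sup>2) + (?k * a - \<alpha> * E (\<lambda>w. B 1 w ^ 4))
      = c - \<alpha> * m\<^sup>2 - \<alpha> * E (\<lambda>w. B 1 w ^ 4) + \<alpha> * a\<^sup>2"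
    by algebra
  finally show ?thesis using \<alpha> zero_le_power2[of a] mult_nonneg_nonneg[of \<alpha> "a\<^sup>2"] by linarith
qed

text \<open>Induction removes the last increment: at the cost of \<open>\<alpha>\<close> times the
  fourth moment, \<open>E_one_step\<close> turns the final square into the one at time
  \<open>n\<close>, where it merges with the weight \<open>v n\<close>. The induction hypothesis is
  therefore applied with \<open>v n + \<alpha>\<close>, so \<open>\<alpha>\<close> has to
  vary.\<close>

lemma E_qv_dev_ge:
  assumes a: "\<sigma>l\<^sup>2 \<le> a" "a \<le> \<sigma>u\<^sup>2" and v: "\<And>k. 0 \<le> v k" and \<alpha>: "0 \<le> \<alpha>"
  shows "- E (\<lambda>w. B 1 w ^ 4) * ((\<Sum>k<n. v k * real k) + \<alpha> * real n)
    \<le> E (\<lambda>w. - (\<Sum>k<n. v k * (qv_dev a k w)\<^sup>2) - \<alpha> * (qv_dev a n w)\<^sup>2)"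
  using \<alpha>
proof (induction n arbitrary: \<alpha>)
  case 0
  show ?case by (simp add: qv_dev_def E_const)
next
  case (Suc n)
  let ?V = "E (\<lambda>w. B 1 w ^ 4)"
  let ?S = "\<lambda>w. - (\<Sum>k<Suc n. v k * (qv_dev a k w)\<^sup>2)"
  \<comment> \<open>The times \<open>0, ..., n\<close> give \<open>Suc n\<close> values of
    \<open>B\<close>. Coordinate \<open>Suc n\<close> of the extended vector is the last increment
    itself; \<open>m k\<close> with \<open>k \<le> n\<close> does not read it.\<close>
  define ts where "ts = map real [0..<Suc n]"
  define m where "m k x = (\<Sum>i<k. (x ! (i + 1) - x ! i)\<^sup>2 - a)" for k and x :: "real list"
  define \<phi> where "\<phi> x = - (\<Sum>k<Suc n. v k * (m k x)\<^sup>2) - \<alpha> * (m n x + ((x ! Suc n)\<^sup>2 - a))\<^sup>2" for x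
  have ts: "length ts = Suc n" "sorted ts" "ts \<noteq> []" "\<And>r. r \<in> set ts \<Longrightarrow> 0 \<le> r \<and> r \<le> real n"
    by (auto simp: ts_def sorted_iff_nth_mono simp del: upt_Suc)
  have m_eq: "m k (map (\<lambda>r. B r w) ts @ y) = qv_dev a k w" if "k \<le> n" for k w y
    unfolding m_def qv_dev_def
    using that by (intro sum.cong refl) (simp add: ts_def nth_append add.commute del: upt_Suc)
  have \<phi>_eq: "\<phi> (map (\<lambda>r. B r w) ts @ [y]) = ?S w - \<alpha> * (qv_dev a n w + (y\<^sup>2 - a))\<^sup>2" for w y
    unfolding \<phi>_def using m_eq ts(1) by (simp add: nth_append)
  have \<phi>: "C_l_Lip (Suc (length ts)) \<phi>"
    unfolding \<phi>_def[abs_def] m_def ts by (intro C_l_Lip_intros) auto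
  let ?Y = "\<lambda>w. B (real n + 1) w - B (real n) w"
  have Y: "?Y \<in> L_ip" by (intro L_ip_intros) auto
  have \<phi>Y: "(\<lambda>w. \<phi> (x @ [?Y w])) \<in> L_ip" if "length x = Suc n" for x
  proof -
    have "(\<lambda>w. (x @ [?Y w]) ! i) \<in> L_ip" if "i \<le> Suc n" for i
      using that \<open>length x = Suc n\<close> Y by (cases "i = Suc n") (auto simp: nth_append intro: L_ip_const)
    then show ?thesis
      unfolding \<phi>_def m_def by (intro L_ip_intros) auto
  qed
  have L: "(\<lambda>w. E (\<lambda>w'. \<phi> (map (\<lambda>r. B r w) ts @ [?Y w']))) \<in> L_ip"
    using C_l_Lip_E_append[OF \<phi> Y] \<phi>Y ts by (intro L_ipI) auto
  have LS: "(\<lambda>w. ?S w - \<alpha> * (qv_dev a n w)\<^sup>2) \<in> L_ip"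
    by (intro L_ip_intros L_ip_qv_dev)
  have "- ?V * ((\<Sum>k<Suc n. v k * real k) + \<alpha> * real (Suc n))
      = - (\<alpha> * ?V) + - ?V * ((\<Sum>k<n. v k * real k) + (v n + \<alpha>) * real n)"
    by (simp add: algebra_simps)
  also have "\<dots> \<le> - (\<alpha> * ?V)
      + E (\<lambda>w. - (\<Sum>k<n. v k * (qv_dev a k w)\<^sup>2) - (v n + \<alpha>) * (qv_dev a n w)\<^sup>2)"
    using Suc v by (intro add_left_mono Suc.IH) auto
  also have "\<dots> = - (\<alpha> * ?V) + E (\<lambda>w. ?S w - \<alpha> * (qv_dev a n w)\<^sup>2)"
    by (simp add: distrib_right diff_diff_eq)
  also have "\<dots> = E (\<lambda>w. - (\<alpha> * ?V) + (?S w - \<alpha> * (qv_dev a n w)\<^sup>2))"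
    by (rule E_add_const[OF LS, symmetric])
  also have "\<dots> \<le> E (\<lambda>w. E (\<lambda>w'. \<phi> (map (\<lambda>r. B r w) ts @ [?Y w'])))"
  proof (rule E_mono[OF L_ip_add[OF L_ip_const LS] L])
    fix w
    show "- (\<alpha> * ?V) + (?S w - \<alpha> * (qv_dev a n w)\<^sup>2) \<le> E (\<lambda>w'. \<phi> (map (\<lambda>r. B r w) ts @ [?Y w']))"
      unfolding \<phi>_eq using E_one_step[OF a, of "real n" \<alpha> "?S w" "qv_dev a n w"] Suc.prems by simp
  qed
  also have "\<dots> = E (\<lambda>w. \<phi> (map (\<lambda>r. B r w) ts @ [?Y w]))"
    by (rule E_indep_increment[symmetric, OF _ _ ts(2,4) \<phi>]) auto
  also have "\<dots> = E (\<lambda>w. ?S w - \<alpha> * (qv_dev a (Suc n) w)\<^sup>2)"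
    unfolding \<phi>_eq by (simp add: qv_dev_def)
  finally show ?case .
qed

end

end

section \<open>The capacity of a representing family\<close>

context
  fixes \<P> :: "cpath measure set" and E :: "(cpath \<Rightarrow> real) \<Rightarrow> real"
  assumes rep: "represents \<P> E"
begin

lemma path_measuresD: "P \<in> \<P> \<Longrightarrow> prob_space P" "P \<in> \<P> \<Longrightarrow> sets P = sets borel"
  using rep unfolding represents_def path_measures_def by blast+

lemma measure_le_capacity: "P \<in> \<P> \<Longrightarrow> measure P A \<le> capacity \<P> A"
  unfolding capacity_def
  by (intro cSUP_upper bdd_aboveI2[of _ _ 1] prob_space.prob_le_1 path_measuresD(1))

lemma represents_nonempty: "\<P> \<noteq> {}"
  using rep L_ip_const[of 0] unfolding represents_def by blast

lemma capacity_empty: "capacity \<P> {} = 0"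
  using represents_nonempty by (simp add: capacity_def)

lemma capacity_mono:
  assumes "A \<subseteq> A'" "A' \<in> sets borel"
  shows "capacity \<P> A \<le> capacity \<P> A'"
  unfolding capacity_def[of _ A]
proof (rule cSUP_least[OF represents_nonempty])
  fix P assume P: "P \<in> \<P>"
  then interpret prob_space P by (rule path_measuresD)
  have "measure P A \<le> measure P A'"
    using assms path_measuresD(2)[OF P] by (intro finite_measure_mono) auto
  with measure_le_capacity[OF P, of A'] show "measure P A \<le> capacity \<P> A'" by simp
qed

text \<open>The maximum \<open>E X\<close> is attained at some \<open>P\<close>, under which the
  integral of \<open>X\<close> is at most \<open>measure P A\<close>. Lower bounds on expectations
  thus become lower bounds on capacities.\<close>

lemma E_le_capacity:
  assumes "X \<in> L_ip" "A \<in> sets borel" "\<And>w. X w \<le> indicator A w"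
  shows "E X \<le> capacity \<P> A"
proof -
  obtain P where P: "P \<in> \<P>" "integrable P X" "integral\<^sup>L P X = E X"
    using rep assms(1) unfolding represents_def by blast
  interpret prob_space P using P by (intro path_measuresD)
  have A: "A \<in> sets P" using assms(2) path_measuresD(2)[OF P(1)] by simp
  have "integral\<^sup>L P X \<le> integral\<^sup>L P (indicator A)"
    using assms(3) A P(2) by (intro integral_mono) (auto simp: less_top[symmetric])
  also have "\<dots> = measure P A" using A by (simp add: sets.Int_space_eq2)
  finally show ?thesis using P measure_le_capacity[OF P(1), of A] by simp
qed

end

section \<open>The events \<open>qv_event\<close>: monotonicity, disjointness and capacity\<close>

text \<open>
  Under an i.i.d. step law with mean square \<open>a\<close>, the expectation of the \<open>k\<close>-th summand is of order
  \<open>k\<^sup>-\<^sup>2\<close>, whereas replacing \<open>a\<close> by another value makes it of order \<open>k\<^sup>-\<^sup>1\<close>.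
\<close>

definition qv_event :: "real \<Rightarrow> real \<Rightarrow> nat \<Rightarrow> cpath set" where
  "qv_event c a n = {w. (\<Sum>k<n. c / real k ^ 3 * (qv_dev a k w)\<^sup>2) \<le> 1}"

lemma sets_qv_event: "qv_event c a n \<in> sets borel"
proof -
  have "{w \<in> space borel. (\<Sum>k<n. c / real k ^ 3 * (qv_dev a k w)\<^sup>2) \<le> 1} \<in> sets borel"
    by measurable
  then show ?thesis by (simp add: qv_event_def)
qed

lemma decseq_qv_event: "0 \<le> c \<Longrightarrow> decseq (qv_event c a)"
  unfolding qv_event_def
  by (intro decseq_SucI Collect_mono impI) (erule order_trans[rotated], simp)

text \<open>On a common path both weighted sums stay at most 1, while by \<open>qv_dev_diff\<close>
  their \<open>k\<close>-th summands together exceed a fixed multiple of the harmonic term; the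
  harmonic series would converge.\<close>

lemma qv_event_disjoint:
  assumes c: "0 < c" and "a \<noteq> b"
  shows "(\<Inter>n. qv_event c a n) \<inter> (\<Inter>n. qv_event c b n) = {}"
proof (rule ccontr)
  assume "\<not> ?thesis"
  then obtain w where w: "\<And>n. w \<in> qv_event c a n" "\<And>n. w \<in> qv_event c b n" by blast
  have d: "0 < c * (b - a)\<^sup>2" using assms by simp
  have "(\<Sum>k<n. inverse (real k)) \<le> 4 / (c * (b - a)\<^sup>2)" for n
  proof -
    have "c * (b - a)\<^sup>2 * inverse (real k)
        \<le> 2 * (c / real k ^ 3 * (qv_dev a k w)\<^sup>2 + c / real k ^ 3 * (qv_dev b k w)\<^sup>2)" for k
    \<comment> \<open>At \<open>k = 0\<close> both sides are 0, since division by zero yields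
      0.\<close>
    proof (cases "k = 0")
      case False
      have "(real k)\<^sup>2 * (b - a)\<^sup>2 = (qv_dev a k w - qv_dev b k w)\<^sup>2"
        by (simp add: qv_dev_diff power_mult_distrib)
      also have "\<dots> \<le> 2 * ((qv_dev a k w)\<^sup>2 + (qv_dev b k w)\<^sup>2)"
        using zero_le_power2[of "qv_dev a k w + qv_dev b k w"] by (simp add: power2_sum power2_diff)
      finally have "c / real k ^ 3 * ((real k)\<^sup>2 * (b - a)\<^sup>2)
          \<le> c / real k ^ 3 * (2 * ((qv_dev a k w)\<^sup>2 + (qv_dev b k w)\<^sup>2))"
        using c by (intro mult_left_mono) auto
      moreover have "c / real k ^ 3 * ((real k)\<^sup>2 * (b - a)\<^sup>2) = c * (b - a)\<^sup>2 * inverse (real k)"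
        using False by (simp add: field_simps power2_eq_square power3_eq_cube)
      ultimately show ?thesis by (simp add: algebra_simps)
    qed simp
    then have "(\<Sum>k<n. c * (b - a)\<^sup>2 * inverse (real k))
        \<le> (\<Sum>k<n. 2 * (c / real k ^ 3 * (qv_dev a k w)\<^sup>2 + c / real k ^ 3 * (qv_dev b k w)\<^sup>2))"
      by (rule sum_mono)
    also have "\<dots> = 2 * ((\<Sum>k<n. c / real k ^ 3 * (qv_dev a k w)\<^sup>2)
        + (\<Sum>k<n. c / real k ^ 3 * (qv_dev b k w)\<^sup>2))"
      by (simp only: sum_distrib_left[symmetric] sum.distrib)
    also have "\<dots> \<le> 4" using w[of n] by (simp add: qv_event_def)
    finally have "c * (b - a)\<^sup>2 * (\<Sum>k<n. inverse (real k)) \<le> 4" by (simp add: sum_distrib_left)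
    then show ?thesis using d by (simp add: pos_le_divide_eq mult.commute)
  qed
  then have "summable (\<lambda>k. inverse (real k))"
    by (intro summableI_nonneg_bounded[where x = "4 / (c * (b - a)\<^sup>2)"]) auto
  then show False using not_summable_harmonic[where ?'a = real] by simp
qed

text \<open>Markov's inequality combined with \<open>E_qv_dev_ge\<close> for the weights
  \<open>c / real k ^ 3\<close>. One \<open>c\<close> serves all \<open>a\<close>, as
  \<open>qv_event_disjoint\<close> requires, because the moment bound involves only the fourth
  moment of \<open>B 1\<close>.\<close>

lemma capacity_qv_event_ge:
  assumes E: "G_expectation \<sigma>l \<sigma>u E" and rep: "represents \<P> E"
  obtains c where "0 < c"
    "\<And>a n. \<sigma>l\<^sup>2 \<le> a \<Longrightarrow> a \<le> \<sigma>u\<^sup>2 \<Longrightarrow> 1 / 2 \<le> capacity \<P> (qv_event c a n)"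
proof -
  have E1: "sublinear_expectation E" and E2: "G_Brownian_motion \<sigma>l \<sigma>u E"
    using E by (auto simp: G_expectation_def)
  define V where "V = E (\<lambda>w. B 1 w ^ 4)"
  have "0 \<le> V"
    using E_mono[OF E1 L_ip_const[of 0] L_ip_power[OF L_ip_B[of 1], of 4]]
    by (simp add: V_def E_const[OF E1])
  define S where "S = (\<Sum>k. 1 / (real k)\<^sup>2)"
  have sm: "summable (\<lambda>k. 1 / (real k)\<^sup>2)"
    using inverse_power_summable[of 2, where ?'a = real] by (simp add: inverse_eq_divide)
  have S: "(\<Sum>k<n. 1 / (real k)\<^sup>2) \<le> S" for n
    unfolding S_def by (intro sum_le_suminf sm) auto
  have "0 \<le> S" using S[of 0] by simp
  \<comment> \<open>This makes \<open>V * (c * S) = V * S / (2 * V * S + 1)\<close>, which is below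
    1/2; the added 1 keeps the denominator positive if \<open>V = 0\<close>.\<close>
  define c where "c = 1 / (2 * V * S + 1)"
  have c: "0 < c" using \<open>0 \<le> V\<close> \<open>0 \<le> S\<close> by (simp add: c_def add_nonneg_pos)
  have VS: "V * (c * S) \<le> 1 / 2"
    using mult_nonneg_nonneg[OF \<open>0 \<le> V\<close> \<open>0 \<le> S\<close>] by (simp add: c_def divide_le_eq mult_ac)
  have "1 / 2 \<le> capacity \<P> (qv_event c a n)" if a: "\<sigma>l\<^sup>2 \<le> a" "a \<le> \<sigma>u\<^sup>2" for a n
  proof -
    let ?v = "\<lambda>k. c / real k ^ 3" and ?X = "\<lambda>w. - (\<Sum>k<n. c / real k ^ 3 * (qv_dev a k w)\<^sup>2)"
    have X: "?X \<in> L_ip" by (intro L_ip_intros L_ip_qv_dev)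
    have "(\<Sum>k<n. ?v k * real k) = c * (\<Sum>k<n. 1 / (real k)\<^sup>2)"
      unfolding sum_distrib_left
      by (intro sum.cong refl) (simp add: power2_eq_square power3_eq_cube)
    also have "\<dots> \<le> c * S" using S c by simp
    finally have "V * (\<Sum>k<n. ?v k * real k) \<le> V * (c * S)" using \<open>0 \<le> V\<close> by (rule mult_left_mono)
    with VS have "1 / 2 \<le> 1 + - V * (\<Sum>k<n. ?v k * real k)" by simp
    also have "\<dots> \<le> 1 + E ?X"
      using E_qv_dev_ge[OF E1 E2 a, of ?v 0 n] c by (simp add: V_def)
    also have "\<dots> = E (\<lambda>w. 1 + ?X w)" by (rule E_add_const[OF E1 X, symmetric])
    also have "\<dots> \<le> capacity \<P> (qv_event c a n)"
    proof (rule E_le_capacity[OF rep L_ip_add[OF L_ip_const X] sets_qv_event])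
      fix w
      have "0 \<le> (\<Sum>k<n. c / real k ^ 3 * (qv_dev a k w)\<^sup>2)"
        using c by (intro sum_nonneg) auto
      \<comment> \<open>Off the event the sum exceeds 1 and the left side is negative; on the event
        it is at most 1 because the sum is nonnegative.\<close>
      then show "1 + ?X w \<le> indicator (qv_event c a n) w"
        by (auto simp: qv_event_def indicator_def)
    qed
    finally show ?thesis .
  qed
  with c show thesis by (rule that)
qed

section \<open>Disjoint events of capacity at least 1/2 against continuity from above\<close>

theorem corollary4p1:
  fixes \<sigma>l \<sigma>u :: real
    and E :: "(cpath \<Rightarrow> real) \<Rightarrow> real"
    and \<P> :: "cpath measure set"
  assumes "0 \<le> \<sigma>l\<^sup>2" and "\<sigma>l\<^sup>2 \<le> \<sigma>u\<^sup>2"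
    and "G_expectation \<sigma>l \<sigma>u E"
    and "compactin weak_topology \<P>"
    and "represents \<P> E"
    and "\<sigma>l\<^sup>2 \<noteq> \<sigma>u\<^sup>2"
  shows "\<not> continuous_capacity (capacity \<P>)"
proof
  assume cont: "continuous_capacity (capacity \<P>)"
  have lim: "(\<lambda>n. capacity \<P> (A n)) \<longlonglongrightarrow> capacity \<P> (\<Inter>n. A n)"
    if "\<And>n. A n \<in> sets borel" "decseq A" for A
    using cont that unfolding continuous_capacity_def by blast
  obtain c where c: "0 < c"
    and cap: "\<And>a n. \<sigma>l\<^sup>2 \<le> a \<Longrightarrow> a \<le> \<sigma>u\<^sup>2 \<Longrightarrow> 1 / 2 \<le> capacity \<P> (qv_event c a n)"
    using capacity_qv_event_ge[OF assms(3,5)] by blast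
  \<comment> \<open>Infinitely many distinct values in the variance interval, falling from
    \<open>\<sigma>u\<^sup>2\<close> towards \<open>\<sigma>l\<^sup>2\<close>.\<close>
  define a where "a j = \<sigma>l\<^sup>2 + (\<sigma>u\<^sup>2 - \<sigma>l\<^sup>2) / real (Suc j)" for j
  have d: "0 < \<sigma>u\<^sup>2 - \<sigma>l\<^sup>2" using assms(2,6) by simp
  have a: "\<sigma>l\<^sup>2 \<le> a j" "a j \<le> \<sigma>u\<^sup>2" for j
    using d divide_left_mono[of 1 "real (Suc j)" "\<sigma>u\<^sup>2 - \<sigma>l\<^sup>2"] by (auto simp: a_def)
  have "inj a" using d by (auto simp: a_def inj_on_def simp del: of_nat_Suc)
  define F where "F j = (\<Inter>n. qv_event c (a j) n)" for j
  have F: "F j \<in> sets borel" for j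
    unfolding F_def by (rule sets.countable_INT) (auto simp: sets_qv_event)
  \<comment> \<open>First use of continuity: the bound passes from the decreasing events to their
    intersection.\<close>
  have cap_F: "1 / 2 \<le> capacity \<P> (F j)" for j
  proof -
    have "(\<lambda>n. capacity \<P> (qv_event c (a j) n)) \<longlonglongrightarrow> capacity \<P> (F j)"
      unfolding F_def using c by (intro lim sets_qv_event decseq_qv_event) auto
    then show ?thesis by (rule LIMSEQ_le_const) (intro exI allI impI cap a)
  qed
  \<comment> \<open>A path lies in at most one \<open>F j\<close> and hence in none of the tails
    beyond that \<open>j\<close>, so the tails decrease to the empty set.\<close>
  define A where "A n = (\<Union>j\<in>{n..}. F j)" for n
  have A: "A n \<in> sets borel" for n unfolding A_def using F by auto
  have F_disjoint: "i = j" if "w \<in> F i" "w \<in> F j" for i j w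
    using qv_event_disjoint[OF c, of "a i" "a j"] \<open>inj a\<close> that by (auto simp: F_def inj_eq)
  have "w \<notin> (\<Inter>n. A n)" for w
  proof
    assume w: "w \<in> (\<Inter>n. A n)"
    then obtain i where i: "w \<in> F i" by (auto simp: A_def)
    from w have "w \<in> A (Suc i)" by blast
    then obtain j where "Suc i \<le> j" "w \<in> F j" by (auto simp: A_def)
    with F_disjoint[OF i, of j] show False by simp
  qed
  then have "(\<Inter>n. A n) = {}" by blast
  moreover have "decseq A" unfolding A_def decseq_def by (intro allI impI UN_mono) auto
  \<comment> \<open>Second use of continuity: the capacities of the tails tend to 0, although each
    tail \<open>A n\<close> contains \<open>F n\<close>.\<close>
  ultimately have lim_A: "(\<lambda>n. capacity \<P> (A n)) \<longlonglongrightarrow> 0"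
    using lim[of A, OF A] capacity_empty[OF assms(5)] by simp
  have cap_A: "1 / 2 \<le> capacity \<P> (A n)" for n
  proof -
    have "F n \<subseteq> A n" by (auto simp: A_def)
    then show ?thesis by (rule order_trans[OF cap_F capacity_mono[OF assms(5) _ A]])
  qed
  have "(1 / 2 :: real) \<le> 0"
    by (rule LIMSEQ_le_const[OF lim_A]) (intro exI allI impI cap_A)
  then show False by simp
qed

end
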